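(* Consider a run of Algorithm SOFTMAX-ADVERSARIAL (defined in the context) with no limit on the number of iterations ($t^{\max}=\infty$). Assume that the features are uniformly continuous over $\mathcal{Z}$ in the following sense: for every $\epsilon>0$ there exists $\gamma(\epsilon)>0$ such that for all $z,w\in\mathcal{Z}$ with $\|z-w\|<\gamma(\epsilon)$ one has $|\phi_i(x\,|\,z)-\phi_i(x\,|\,w)|<\epsilon$ for every $x\in P$ and every $i\in I$. Let $\lambda\in(0,1)$. Then either the algorithm terminates in the stopping test after finitely many iterations, or it reaches an iteration $\tau$ with $\phi_{\max}^{\tau}\le\lambda\,\Phi(x^0)$.
   Context: Setting. $P\subseteq\mathbb{R}^n$ is a nonempty set, $c:P\to\mathbb{R}$ is a cost function, $\mathcal{Z}\subset\mathbb{R}^d$ is a nonempty compact set, $I$ is a nonempty finite set, and for each $i\in I$ there is a nonnegative real-valued function ("feature") $\phi_i(x\,|\,z)$ of $x\in P$, $z\in\mathcal{Z}$. Define $\Phi(x)=\max_{z\in\mathcal{Z}}\max_{i\in I}\phi_i(x\,|\,z)$ for $x\in P$. All minima and maxima written here are assumed to be attained. Algorithm SOFTMAX-ADVERSARIAL. Inputs: $\Theta>0$, $\alpha>0$, tolerances $\Delta>0$, $0<\delta<1$, $\Delta'>0$, and a maximum iteration count $t^{\max}$. The initial master problem is $\min\{c(x)+\Theta\,\Phi_L : x\in P,\ \Phi_L\ge 0\}$ in the variables $(x,\Phi_L)$. For $t=0,1,2,\dots$ (while $t<t^{\max}$): 1. Let $(x^t,\Phi_L^t)$ be an optimal solution of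 the current master problem. 2. (Boosting) Compute $z^t\in\mathcal{Z}$ with $\ln\sum_{i\in I}e^{\alpha\phi_i(x^t|z^t)}\ \ge\ \max_{z\in\mathcal{Z}}\ln\sum_{i\in I}e^{\alpha\phi_i(x^t|z)}-\Delta'$. Set $\phi_{\max}^t=\max_{i\in I}\phi_i(x^t\,|\,z^t)$. 3. (Stopping test) If (a) $\phi_{\max}^t\le\Phi_L^t+\Delta$ or (b) $\phi_{\max}^t-\Phi_L^t\le\delta\,\phi_{\max}^t$, stop. 4. (Separation) Otherwise, set $\pi_i^t=e^{\alpha\phi_i(x^t|z^t)}/\sum_{j\in I}e^{\alpha\phi_j(x^t|z^t)}$ for $i\in I$, add the constraint $\Phi_L\ge\sum_{i\in I}\pi_i^t\,\phi_i(x\,|\,z^t)$ to the master problem, and go to iteration $t+1$. Standing parameter choice: $\Delta'=\alpha\Delta$ and $\alpha\ge\dfrac{\ln|I|+[\ln(2\Phi(x^0)/\Delta)]^+}{\Delta}$, where $[r]^+=\max\{r,0\}$ and $[\ln 0]^+$ is read as $0$. ($\alpha$ is first needed only after $x^0$ has been computed.) *)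

theory Defs
  imports "HOL-Analysis.Analysis" "HOL-Library.Extended_Nat"
begin

text \<open>
  The feature \<open>\<phi>\<^sub>i(x | z)\<close> is written \<open>\<phi> i x z\<close>. Functions on \<open>P\<close> and on \<open>Z\<close> are total
  functions on the ambient space and are only ever constrained on \<open>P\<close> and \<open>Z\<close>.
\<close>

definition feature_max :: "'i set \<Rightarrow> ('i \<Rightarrow> 'x \<Rightarrow> 'z \<Rightarrow> real) \<Rightarrow> 'x \<Rightarrow> 'z \<Rightarrow> real" where
  "feature_max I \<phi> x z = (MAX i\<in>I. \<phi> i x z)"

text \<open>
  Maxima over \<open>Z\<close> are rendered as suprema; they agree with the maxima as soon as the latter
  are attained, which has to be assumed (or derived) where these functions are used.
\<close>

definition Phi :: "'z set \<Rightarrow> 'i set \<Rightarrow> ('i \<Rightarrow> 'x \<Rightarrow> 'z \<Rightarrow> real) \<Rightarrow> 'x \<Rightarrow> real" where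
  "Phi Z I \<phi> x = (SUP z\<in>Z. feature_max I \<phi> x z)"

definition log_sum_exp ::
    "real \<Rightarrow> 'i set \<Rightarrow> ('i \<Rightarrow> 'x \<Rightarrow> 'z \<Rightarrow> real) \<Rightarrow> 'x \<Rightarrow> 'z \<Rightarrow> real" where
  "log_sum_exp \<alpha> I \<phi> x z = ln (\<Sum>i\<in>I. exp (\<alpha> * \<phi> i x z))"

definition softmax_weight ::
    "real \<Rightarrow> 'i set \<Rightarrow> ('i \<Rightarrow> 'x \<Rightarrow> 'z \<Rightarrow> real) \<Rightarrow> 'x \<Rightarrow> 'z \<Rightarrow> 'i \<Rightarrow> real" where
  "softmax_weight \<alpha> I \<phi> x z i = exp (\<alpha> * \<phi> i x z) / (\<Sum>j\<in>I. exp (\<alpha> * \<phi> j x z))"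

text \<open>
  Feasible pairs \<open>(y, v)\<close>, with \<open>v\<close> in the role of \<open>\<Phi>\<^sub>L\<close>, of the master problem solved in
  iteration \<open>t\<close>: it carries one cut for each of the iterations \<open>0, \<dots>, t - 1\<close>.
\<close>

definition master_feasible ::
    "'x set \<Rightarrow> 'i set \<Rightarrow> ('i \<Rightarrow> 'x \<Rightarrow> 'z \<Rightarrow> real) \<Rightarrow> real
      \<Rightarrow> (nat \<Rightarrow> 'x) \<Rightarrow> (nat \<Rightarrow> 'z) \<Rightarrow> nat \<Rightarrow> ('x \<times> real) set" where
  "master_feasible P I \<phi> \<alpha> x z t =
     {(y, v). y \<in> P \<and> v \<ge> 0 \<and>
        (\<forall>s<t. v \<ge> (\<Sum>i\<in>I. softmax_weight \<alpha> I \<phi> (x s) (z s) i * \<phi> i y (z s)))}"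

definition stopping_test ::
    "'i set \<Rightarrow> ('i \<Rightarrow> 'x \<Rightarrow> 'z \<Rightarrow> real) \<Rightarrow> real \<Rightarrow> real
      \<Rightarrow> (nat \<Rightarrow> 'x) \<Rightarrow> (nat \<Rightarrow> real) \<Rightarrow> (nat \<Rightarrow> 'z) \<Rightarrow> nat \<Rightarrow> bool" where
  "stopping_test I \<phi> \<Delta> \<delta> x L z t \<longleftrightarrow>
     feature_max I \<phi> (x t) (z t) \<le> L t + \<Delta> \<or>
     feature_max I \<phi> (x t) (z t) - L t \<le> \<delta> * feature_max I \<phi> (x t) (z t)"

definition reaches ::
    "'i set \<Rightarrow> ('i \<Rightarrow> 'x \<Rightarrow> 'z \<Rightarrow> real) \<Rightarrow> real \<Rightarrow> real \<Rightarrow> enat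
      \<Rightarrow> (nat \<Rightarrow> 'x) \<Rightarrow> (nat \<Rightarrow> real) \<Rightarrow> (nat \<Rightarrow> 'z) \<Rightarrow> nat \<Rightarrow> bool" where
  "reaches I \<phi> \<Delta> \<delta> tmax x L z t \<longleftrightarrow>
     enat t < tmax \<and> (\<forall>s<t. \<not> stopping_test I \<phi> \<Delta> \<delta> x L z s)"

text \<open>
  A run is given by the iterates \<open>x t\<close>, \<open>L t\<close> (the value \<open>\<Phi>\<^sub>L\<close>) and \<open>z t\<close>. These are sequences over
  all of \<open>nat\<close>, but entries belonging to iterations that are not reached are arbitrary.
  Every choice of optimal master solutions and of near-maximizers \<open>z t\<close> is allowed.
\<close>

definition softmax_adversarial_run ::
    "'x set \<Rightarrow> ('x \<Rightarrow> real) \<Rightarrow> 'z set \<Rightarrow> 'i set \<Rightarrow> ('i \<Rightarrow> 'x \<Rightarrow> 'z \<Rightarrow> real)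
      \<Rightarrow> real \<Rightarrow> real \<Rightarrow> real \<Rightarrow> real \<Rightarrow> real \<Rightarrow> enat
      \<Rightarrow> (nat \<Rightarrow> 'x) \<Rightarrow> (nat \<Rightarrow> real) \<Rightarrow> (nat \<Rightarrow> 'z) \<Rightarrow> bool" where
  "softmax_adversarial_run P c Z I \<phi> \<Theta> \<alpha> \<Delta> \<delta> \<Delta>' tmax x L z \<longleftrightarrow>
     (\<forall>t. reaches I \<phi> \<Delta> \<delta> tmax x L z t \<longrightarrow>
        is_arg_min (\<lambda>(y, v). c y + \<Theta> * v) (\<lambda>p. p \<in> master_feasible P I \<phi> \<alpha> x z t) (x t, L t) \<and>
        z t \<in> Z \<and>
        log_sum_exp \<alpha> I \<phi> (x t) (z t) \<ge> (SUP w\<in>Z. log_sum_exp \<alpha> I \<phi> (x t) w) - \<Delta>')"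

text \<open>\<open>[ln r]\<^sup>+\<close> for \<open>r \<ge> 0\<close>, with the convention \<open>[ln 0]\<^sup>+ = 0\<close>.\<close>

definition ln_plus :: "real \<Rightarrow> real" where
  "ln_plus r = (if r = 0 then 0 else max (ln r) 0)"

end

theory Submission
  imports Defs
begin

text \<open>
  Suppose the run never stops. By compactness of the simplex and of \<open>Z\<close> there are iterations \<open>s < t\<close>
  whose weight vectors and whose points \<open>z\<close> almost agree, so the cut added in iteration \<open>s\<close> forces
  \<open>L t\<close> to be almost as large as the softmax average of the features at \<open>(x t, z t)\<close>. The entropy
  bound puts this average within \<open>ln (card I) / \<alpha>\<close> of the maximal feature. Because the test
  fails already in iteration \<open>0\<close>, \<open>Phi Z I \<phi> (x 0) > \<Delta>\<close>, so the choice of \<open>\<alpha>\<close> makes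
  \<open>ln (card I) / \<alpha>\<close> smaller than \<open>\<Delta>\<close> by the fixed amount \<open>ln 2 / \<alpha>\<close>. This slack absorbs
  the errors, and the test succeeds in iteration \<open>t\<close>.
\<close>

lemma softmax_weight_pos:
  assumes "finite I" "i \<in> I"
  shows "softmax_weight \<alpha> I \<phi> y w i > 0"
  unfolding softmax_weight_def using assms by (intro divide_pos_pos sum_pos) auto

lemma sum_softmax_weight:
  assumes "finite I" "I \<noteq> {}"
  shows "(\<Sum>i\<in>I. softmax_weight \<alpha> I \<phi> y w i) = 1"
proof -
  have "(\<Sum>j\<in>I. exp (\<alpha> * \<phi> j y w)) > 0"
    using assms by (intro sum_pos) auto
  then show ?thesis
    unfolding softmax_weight_def by (simp flip: sum_divide_distrib)
qed

text \<open>Gibbs' inequality against the uniform distribution: apply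
  \<open>ln u \<le> u - 1\<close> at \<open>u = 1 / (n * p i)\<close> with
  \<open>n = card I\<close>, weight by \<open>p i\<close> and sum. The right-hand sides add up to
  0.\<close>

lemma entropy_le_ln_card:
  fixes p :: "'i \<Rightarrow> real"
  assumes "finite I" "I \<noteq> {}" and pos: "\<And>i. i \<in> I \<Longrightarrow> p i > 0" and sum1: "(\<Sum>i\<in>I. p i) = 1"
  shows "- (\<Sum>i\<in>I. p i * ln (p i)) \<le> ln (real (card I))"
proof -
  define n where "n = real (card I)"
  have n: "n > 0"
    using assms(1,2) by (simp add: n_def card_gt_0_iff)
  have "p i * (- ln (p i) - ln n) \<le> 1 / n - p i" if "i \<in> I" for i
  proof -
    have "ln (1 / (n * p i)) \<le> 1 / (n * p i) - 1"
      using pos[OF that] n by (intro ln_le_minus_one) simp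
    then have "- ln (p i) - ln n \<le> 1 / (n * p i) - 1"
      using pos[OF that] n by (simp add: ln_div ln_mult)
    then have "p i * (- ln (p i) - ln n) \<le> p i * (1 / (n * p i) - 1)"
      using pos[OF that] by (intro mult_left_mono) auto
    also have "\<dots> = 1 / n - p i"
      using pos[OF that] n by (simp add: field_simps)
    finally show ?thesis .
  qed
  then have "(\<Sum>i\<in>I. p i * (- ln (p i) - ln n)) \<le> (\<Sum>i\<in>I. 1 / n - p i)"
    by (intro sum_mono)
  also have "\<dots> = 0"
    using n sum1 by (simp add: sum_subtractf n_def)
  also have "(\<Sum>i\<in>I. p i * (- ln (p i) - ln n)) = - (\<Sum>i\<in>I. p i * ln (p i)) - (\<Sum>i\<in>I. p i) * ln n"
    by (simp add: right_diff_distrib sum_subtractf sum_negf sum_distrib_right)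
  finally show ?thesis
    by (simp add: sum1 n_def)
qed

lemma feature_le_feature_max:
  assumes "finite I" "i \<in> I"
  shows "\<phi> i y w \<le> feature_max I \<phi> y w"
  unfolding feature_max_def using assms by (intro Max_ge) auto

text \<open>With \<open>S\<close> the sum of the exponentials, the logarithm of each weight is
  \<open>\<alpha> * \<phi> i y w - ln S\<close>. Hence \<alpha> times the average is
  \<open>ln S\<close> minus the entropy of the weights. The term of a maximal feature alone gives
  \<open>ln S \<ge> \<alpha> * feature_max I \<phi> y w\<close>, and the entropy is at most
  \<open>ln (card I)\<close>.\<close>

lemma softmax_average_ge:
  assumes "finite I" "I \<noteq> {}" "\<alpha> > 0"
  shows "feature_max I \<phi> y w - ln (real (card I)) / \<alpha>
           \<le> (\<Sum>i\<in>I. softmax_weight \<alpha> I \<phi> y w i * \<phi> i y w)"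
proof -
  let ?p = "softmax_weight \<alpha> I \<phi> y w" and ?M = "feature_max I \<phi> y w"
  let ?S = "\<Sum>i\<in>I. exp (\<alpha> * \<phi> i y w)"
  have S: "?S > 0"
    using assms by (intro sum_pos) auto
  have "?M \<in> (\<lambda>i. \<phi> i y w) ` I"
    unfolding feature_max_def using assms by (intro Max_in) auto
  then obtain k where k: "k \<in> I" "?M = \<phi> k y w"
    by auto
  have "exp (\<alpha> * ?M) \<le> ?S"
    unfolding k(2) using assms k(1) by (intro member_le_sum) auto
  then have "\<alpha> * ?M \<le> ln ?S"
    using S by (simp add: ln_ge_iff)
  moreover have "(\<Sum>i\<in>I. ?p i * ln (?p i)) = (\<Sum>i\<in>I. ?p i * (\<alpha> * \<phi> i y w - ln ?S))"
    using S by (intro sum.cong) (auto simp: softmax_weight_def ln_div)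
  moreover have "\<dots> = \<alpha> * (\<Sum>i\<in>I. ?p i * \<phi> i y w) - (\<Sum>i\<in>I. ?p i) * ln ?S"
    by (simp add: right_diff_distrib sum_subtractf sum_distrib_left sum_distrib_right mult_ac)
  moreover have "- (\<Sum>i\<in>I. ?p i * ln (?p i)) \<le> ln (real (card I))"
    using assms by (intro entropy_le_ln_card softmax_weight_pos sum_softmax_weight)
  ultimately have "\<alpha> * ?M - ln (real (card I)) \<le> \<alpha> * (\<Sum>i\<in>I. ?p i * \<phi> i y w)"
    using assms by (simp add: sum_softmax_weight)
  then have "(\<alpha> * ?M - ln (real (card I))) / \<alpha> \<le> (\<Sum>i\<in>I. ?p i * \<phi> i y w)"
    using assms(3) by (simp add: divide_le_eq mult.commute)
  then show ?thesis
    using assms(3) by (simp add: diff_divide_distrib)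
qed

lemma common_convergent_subseq:
  fixes f :: "'i \<Rightarrow> nat \<Rightarrow> real"
  assumes "finite I" and "\<And>i. i \<in> I \<Longrightarrow> bounded (range (f i))"
  shows "\<exists>r. strict_mono (r :: nat \<Rightarrow> nat) \<and> (\<forall>i\<in>I. convergent (f i \<circ> r))"
  using assms
proof (induction I rule: finite_induct)
  case empty
  show ?case
    by (auto intro: strict_mono_id)
next
  case (insert k I)
  obtain r where r: "strict_mono r" "\<And>i. i \<in> I \<Longrightarrow> convergent (f i \<circ> r)"
    using insert.IH insert.prems by (metis insertCI)
  have "bounded (range (f k \<circ> r))"
    using insert.prems[of k] by (rule bounded_subset) auto
  then obtain l r' where r': "strict_mono r'" "((f k \<circ> r) \<circ> r') \<longlonglongrightarrow> l"
    using bounded_imp_convergent_subsequence by blast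
  have "convergent (f i \<circ> (r \<circ> r'))" if "i \<in> insert k I" for i
  proof (cases "i = k")
    case True
    then show ?thesis
      using r'(2) by (auto simp: convergent_def o_assoc)
  next
    case False
    then show ?thesis
      using that convergent_subseq_convergent[OF r(2) r'(1)] by (simp add: o_assoc)
  qed
  then show ?case
    using strict_mono_o[OF r(1) r'(1)] by blast
qed

text \<open>On a common subsequence along which \<open>z\<close> and every \<open>p i\<close>
  converge, consecutive terms have the same limits, so both distances tend to 0. Any late enough
  consecutive pair serves as \<open>s\<close> and \<open>t\<close>.\<close>

lemma recurrent_pair:
  fixes p :: "'i \<Rightarrow> nat \<Rightarrow> real" and z :: "nat \<Rightarrow> 'z :: metric_space"
  assumes "compact Z" and z: "\<And>t. z t \<in> Z" and "finite I"
    and "\<And>i. i \<in> I \<Longrightarrow> bounded (range (p i))" and "\<gamma> > 0" and "\<eta> > 0"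
  shows "\<exists>s t. s < t \<and> dist (z s) (z t) < \<gamma> \<and> (\<Sum>i\<in>I. \<bar>p i s - p i t\<bar>) < \<eta>"
proof -
  obtain a r where r: "strict_mono r" "(z \<circ> r) \<longlonglongrightarrow> a"
    using assms(1) z unfolding compact_def by blast
  have "bounded (range (p i \<circ> r))" if "i \<in> I" for i
    using assms(4)[OF that] by (rule bounded_subset) auto
  then obtain r' where r': "strict_mono r'" "\<And>i. i \<in> I \<Longrightarrow> convergent (p i \<circ> r \<circ> r')"
    using common_convergent_subseq[OF assms(3), of "\<lambda>i. p i \<circ> r"] by auto
  let ?r = "r \<circ> r'"
  have mono: "strict_mono ?r"
    using r(1) r'(1) by (rule strict_mono_o)
  have "(z \<circ> ?r) \<longlonglongrightarrow> a"
    using LIMSEQ_subseq_LIMSEQ[OF r(2) r'(1)] by (simp add: o_assoc)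
  then have z_lim: "(\<lambda>n. z (?r n)) \<longlonglongrightarrow> a" "(\<lambda>n. z (?r (Suc n))) \<longlonglongrightarrow> a"
    using LIMSEQ_Suc[of "\<lambda>n. z (?r n)"] by (simp_all add: o_def)
  have "(\<lambda>n. dist (z (?r n)) (z (?r (Suc n)))) \<longlonglongrightarrow> 0"
    using tendsto_dist[OF z_lim] by simp
  moreover have "(\<lambda>n. \<Sum>i\<in>I. \<bar>p i (?r n) - p i (?r (Suc n))\<bar>) \<longlonglongrightarrow> (\<Sum>i\<in>I. 0)"
  proof (rule tendsto_sum)
    fix i assume "i \<in> I"
    then obtain l where l: "(\<lambda>n. p i (?r n)) \<longlonglongrightarrow> l"
      using r'(2) by (auto simp: convergent_def o_def)
    from tendsto_rabs[OF tendsto_diff[OF l LIMSEQ_Suc[OF l]]]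
    show "(\<lambda>n. \<bar>p i (?r n) - p i (?r (Suc n))\<bar>) \<longlonglongrightarrow> 0"
      by simp
  qed
  ultimately have "\<forall>\<^sub>F n in sequentially. dist (z (?r n)) (z (?r (Suc n))) < \<gamma> \<and>
      (\<Sum>i\<in>I. \<bar>p i (?r n) - p i (?r (Suc n))\<bar>) < \<eta>"
    using assms(5,6) by (intro eventually_conj) (auto dest: order_tendstoD(2))
  then obtain n where "dist (z (?r n)) (z (?r (Suc n))) < \<gamma>"
      "(\<Sum>i\<in>I. \<bar>p i (?r n) - p i (?r (Suc n))\<bar>) < \<eta>"
    by (auto simp: eventually_sequentially)
  moreover have "?r n < ?r (Suc n)"
    using strict_monoD[OF mono, of n "Suc n"] by simp
  ultimately show ?thesis
    by blast
qed

text \<open>Termwise, \<open>q i * g i - p i * f i = p i * (g i - f i) + (q i - p i) * g i\<close>.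
  The first part costs \<epsilon> in total because the weights \<open>p\<close> sum to 1; the second
  is charged to the distance between the weights.\<close>

lemma weighted_average_perturbation:
  fixes p q f g :: "'i \<Rightarrow> real"
  assumes "finite I" and "\<And>i. i \<in> I \<Longrightarrow> p i \<ge> 0" and "(\<Sum>i\<in>I. p i) = 1"
    and "\<And>i. i \<in> I \<Longrightarrow> \<bar>f i - g i\<bar> \<le> \<epsilon>" and "\<And>i. i \<in> I \<Longrightarrow> \<bar>g i\<bar> \<le> M"
  shows "(\<Sum>i\<in>I. q i * g i) - \<epsilon> - (\<Sum>i\<in>I. \<bar>p i - q i\<bar>) * M \<le> (\<Sum>i\<in>I. p i * f i)"
proof -
  have "q i * g i - p i * \<epsilon> - \<bar>p i - q i\<bar> * M \<le> p i * f i" if "i \<in> I" for i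
  proof -
    have "p i * (g i - f i) \<le> p i * \<epsilon>"
      using assms(2,4)[OF that] by (intro mult_left_mono) auto
    moreover have "(q i - p i) * g i \<le> \<bar>p i - q i\<bar> * M"
    proof -
      have "(q i - p i) * g i \<le> \<bar>p i - q i\<bar> * \<bar>g i\<bar>"
        by (metis abs_ge_self abs_minus_commute abs_mult)
      also have "\<dots> \<le> \<bar>p i - q i\<bar> * M"
        using assms(5)[OF that] by (intro mult_left_mono) auto
      finally show ?thesis .
    qed
    ultimately show ?thesis
      by (simp add: algebra_simps)
  qed
  then have "(\<Sum>i\<in>I. q i * g i - p i * \<epsilon> - \<bar>p i - q i\<bar> * M) \<le> (\<Sum>i\<in>I. p i * f i)"
    by (intro sum_mono)
  then show ?thesis
    using assms(3) by (simp add: sum_subtractf flip: sum_distrib_right)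
qed

theorem theorem2p8:
  fixes P :: "(real ^ 'n) set" and c :: "real ^ 'n \<Rightarrow> real"
    and Z :: "(real ^ 'd) set" and I :: "'i set"
    and \<phi> :: "'i \<Rightarrow> real ^ 'n \<Rightarrow> real ^ 'd \<Rightarrow> real"
    and \<Theta> \<alpha> \<Delta> \<delta> \<Delta>' lam :: real
    and x :: "nat \<Rightarrow> real ^ 'n" and L :: "nat \<Rightarrow> real" and z :: "nat \<Rightarrow> real ^ 'd"
  assumes "P \<noteq> {}" and "compact Z" and "Z \<noteq> {}" and "finite I" and "I \<noteq> {}"
    and nonneg: "\<And>i y w. i \<in> I \<Longrightarrow> y \<in> P \<Longrightarrow> w \<in> Z \<Longrightarrow> \<phi> i y w \<ge> 0"
    and Phi_attained:
      "\<And>y. y \<in> P \<Longrightarrow> \<exists>w\<in>Z. \<forall>w'\<in>Z. feature_max I \<phi> y w' \<le> feature_max I \<phi> y w"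
    and boosting_attained:
      "\<And>y. y \<in> P \<Longrightarrow> \<exists>w\<in>Z. \<forall>w'\<in>Z. log_sum_exp \<alpha> I \<phi> y w' \<le> log_sum_exp \<alpha> I \<phi> y w"
    and "\<Theta> > 0" and "\<alpha> > 0" and "\<Delta> > 0" and "0 < \<delta>" and "\<delta> < 1" and "\<Delta>' > 0"
    and run: "softmax_adversarial_run P c Z I \<phi> \<Theta> \<alpha> \<Delta> \<delta> \<Delta>' \<infinity> x L z"
    and "\<Delta>' = \<alpha> * \<Delta>"
    and "\<alpha> \<ge> (ln (real (card I)) + ln_plus (2 * Phi Z I \<phi> (x 0) / \<Delta>)) / \<Delta>"
    and unif_cont:
      "\<And>\<epsilon>. \<epsilon> > 0 \<Longrightarrow> \<exists>\<gamma>>0. \<forall>w\<in>Z. \<forall>w'\<in>Z. norm (w - w') < \<gamma> \<longrightarrow>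
         (\<forall>y\<in>P. \<forall>i\<in>I. \<bar>\<phi> i y w - \<phi> i y w'\<bar> < \<epsilon>)"
    and "0 < lam" and "lam < 1"
  shows "(\<exists>t. reaches I \<phi> \<Delta> \<delta> \<infinity> x L z t \<and> stopping_test I \<phi> \<Delta> \<delta> x L z t) \<or>
         (\<exists>\<tau>. reaches I \<phi> \<Delta> \<delta> \<infinity> x L z \<tau> \<and>
              feature_max I \<phi> (x \<tau>) (z \<tau>) \<le> lam * Phi Z I \<phi> (x 0))"
proof (rule disjI1, rule ccontr)
  assume none: "\<not> (\<exists>t. reaches I \<phi> \<Delta> \<delta> \<infinity> x L z t \<and> stopping_test I \<phi> \<Delta> \<delta> x L z t)"
  let ?M = "\<lambda>t. feature_max I \<phi> (x t) (z t)"
  let ?p = "\<lambda>i t. softmax_weight \<alpha> I \<phi> (x t) (z t) i"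
  \<comment> \<open>An iteration is reached exactly when no earlier test succeeded, so strong
    induction shows that every iteration is reached and every test fails.\<close>
  have not_stop: "\<not> stopping_test I \<phi> \<Delta> \<delta> x L z t" for t
  proof (induction t rule: less_induct)
    case (less t)
    then have "reaches I \<phi> \<Delta> \<delta> \<infinity> x L z t"
      by (simp add: reaches_def)
    then show ?case
      using none by blast
  qed
  then have reach: "reaches I \<phi> \<Delta> \<delta> \<infinity> x L z t" for t
    by (simp add: reaches_def)
  have zZ: "z t \<in> Z" and feas: "(x t, L t) \<in> master_feasible P I \<phi> \<alpha> x z t" for t
    using run reach[of t] by (auto simp: softmax_adversarial_run_def is_arg_min_def)
  have xP: "x t \<in> P" and L_nonneg: "L t \<ge> 0" for t
    using feas[of t] by (auto simp: master_feasible_def)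
  have cut: "(\<Sum>i\<in>I. ?p i s * \<phi> i (x t) (z s)) \<le> L t" if "s < t" for s t
    using feas[of t] that by (auto simp: master_feasible_def)
  have gap: "?M t > L t + \<Delta>" "?M t - L t > \<delta> * ?M t" for t
    using not_stop[of t] by (auto simp: stopping_test_def)

  have "bdd_above (feature_max I \<phi> (x 0) ` Z)"
    using Phi_attained[OF xP[of 0]] by (auto simp: bdd_above_def)
  then have "?M 0 \<le> Phi Z I \<phi> (x 0)"
    unfolding Phi_def by (rule cSUP_upper[OF zZ])
  then have Phi_gt: "Phi Z I \<phi> (x 0) > \<Delta>"
    using gap(1)[of 0] L_nonneg[of 0] by linarith
  \<comment> \<open>The argument of \<open>ln_plus\<close> is at least 2, hence in the range where
    \<open>ln_plus\<close> is the true logarithm. This is the source of the slack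
    \<open>ln 2\<close>.\<close>
  then have "2 \<le> 2 * Phi Z I \<phi> (x 0) / \<Delta>"
    using \<open>\<Delta> > 0\<close> by (simp add: field_simps)
  then have "ln 2 \<le> ln_plus (2 * Phi Z I \<phi> (x 0) / \<Delta>)"
    by (auto simp: ln_plus_def le_max_iff_disj)
  moreover have "ln (real (card I)) + ln_plus (2 * Phi Z I \<phi> (x 0) / \<Delta>) \<le> \<alpha> * \<Delta>"
    using \<open>\<alpha> \<ge> _\<close> \<open>\<Delta> > 0\<close> by (simp add: divide_le_eq)
  ultimately have slack: "ln (real (card I)) + ln 2 \<le> \<alpha> * \<Delta>"
    by linarith
  define \<sigma> where "\<sigma> = ln 2 / \<alpha>"
  have \<sigma>: "\<sigma> > 0" "ln (real (card I)) / \<alpha> \<le> \<Delta> - \<sigma>"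
    using slack \<open>\<alpha> > 0\<close> by (simp_all add: \<sigma>_def field_simps)
  have "ln (real (card I)) / \<alpha> \<ge> 0"
    using \<open>finite I\<close> \<open>I \<noteq> {}\<close> \<open>\<alpha> > 0\<close> by (simp add: Suc_leI card_gt_0_iff)
  then have "\<sigma> \<le> \<Delta>"
    using \<sigma>(2) by linarith

  \<comment> \<open>The error from changing the weights is \<eta> times \<open>?M t\<close>, and no
    bound on \<open>?M t\<close> uniform in \<open>t\<close> is at hand. The factor \<delta> lets
    the failure of test (b) replace \<open>?M t\<close> by the gap
    \<open>(?M t - L t) / \<delta>\<close>.\<close>
  define \<eta> where "\<eta> = \<delta> * \<sigma> / (2 * \<Delta>)"
  have "\<eta> > 0"
    using \<sigma>(1) \<open>0 < \<delta>\<close> \<open>\<Delta> > 0\<close> by (simp add: \<eta>_def)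
  obtain \<gamma> where "\<gamma> > 0" and close: "\<forall>w\<in>Z. \<forall>w'\<in>Z. norm (w - w') < \<gamma> \<longrightarrow>
      (\<forall>y\<in>P. \<forall>i\<in>I. \<bar>\<phi> i y w - \<phi> i y w'\<bar> < \<sigma> / 2)"
    using unif_cont[OF half_gt_zero[OF \<sigma>(1)]] by (elim exE conjE)
  have p_le: "\<bar>?p i t\<bar> \<le> 1" if "i \<in> I" for i t
  proof -
    have "?p i t \<le> (\<Sum>j\<in>I. ?p j t)"
      using that \<open>finite I\<close> by (intro member_le_sum) (auto intro: less_imp_le softmax_weight_pos)
    then show ?thesis
      using that \<open>finite I\<close> \<open>I \<noteq> {}\<close> softmax_weight_pos[of I i \<alpha> \<phi> "x t" "z t"]
      by (simp add: sum_softmax_weight)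
  qed
  have p_bdd: "bounded (range (?p i))" if "i \<in> I" for i
    using p_le[OF that] by (auto simp: bounded_iff)
  obtain s t where st: "s < t" "dist (z s) (z t) < \<gamma>" "(\<Sum>i\<in>I. \<bar>?p i s - ?p i t\<bar>) < \<eta>"
  proof -
    have "\<exists>s t. s < t \<and> dist (z s) (z t) < \<gamma> \<and> (\<Sum>i\<in>I. \<bar>?p i s - ?p i t\<bar>) < \<eta>"
      by (rule recurrent_pair) fact+
    then show ?thesis
      using that by (elim exE conjE)
  qed
  have M_pos: "?M t > 0"
    using gap(1)[of t] L_nonneg[of t] \<open>\<Delta> > 0\<close> by linarith
  have \<phi>_le: "\<bar>\<phi> i (x t) (z t)\<bar> \<le> ?M t" if "i \<in> I" for i
    using nonneg[OF that xP zZ] feature_le_feature_max[OF \<open>finite I\<close> that] by simp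
  \<comment> \<open>The cut from iteration \<open>s\<close> is evaluated at the new iterate
    \<open>x t\<close>. Its weights and its point \<open>z s\<close> are exchanged for those of
    iteration \<open>t\<close>; moving the point uses up half of the slack \<sigma>.\<close>
  have "(\<Sum>i\<in>I. ?p i t * \<phi> i (x t) (z t)) - \<sigma> / 2 - (\<Sum>i\<in>I. \<bar>?p i s - ?p i t\<bar>) * ?M t
      \<le> (\<Sum>i\<in>I. ?p i s * \<phi> i (x t) (z s))"
  proof (rule weighted_average_perturbation)
    show "\<bar>\<phi> i (x t) (z s) - \<phi> i (x t) (z t)\<bar> \<le> \<sigma> / 2" if "i \<in> I" for i
      using close zZ[of s] zZ[of t] xP[of t] that st(2) by (simp add: dist_norm less_imp_le)
  qed (use \<open>finite I\<close> \<open>I \<noteq> {}\<close> \<phi>_le in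
      \<open>auto simp: sum_softmax_weight intro: less_imp_le softmax_weight_pos\<close>)
  moreover have "(\<Sum>i\<in>I. \<bar>?p i s - ?p i t\<bar>) * ?M t \<le> \<eta> * ?M t"
    using st(3) M_pos by (intro mult_right_mono) auto
  moreover have "?M t - ln (real (card I)) / \<alpha> \<le> (\<Sum>i\<in>I. ?p i t * \<phi> i (x t) (z t))"
    by (rule softmax_average_ge) fact+
  ultimately have upper: "?M t - L t \<le> \<Delta> - \<sigma> / 2 + \<eta> * ?M t"
    using cut[OF st(1)] \<sigma>(2) by linarith
  \<comment> \<open>The remaining slack \<open>\<sigma> / 2\<close> is the fraction \<rho> of
    \<Delta>, and the weight error is less than the same fraction of the gap
    \<open>?M t - L t\<close>. Cancelling \<open>1 - \<rho>\<close>, positive since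
    \<open>\<sigma> \<le> \<Delta>\<close>, leaves a gap below \<Delta>, so test (a) would
    succeed.\<close>
  define \<rho> where "\<rho> = \<sigma> / (2 * \<Delta>)"
  have \<rho>: "0 < \<rho>" "\<rho> < 1" "\<rho> * \<Delta> = \<sigma> / 2" "\<eta> = \<rho> * \<delta>"
    using \<sigma>(1) \<open>\<sigma> \<le> \<Delta>\<close> \<open>\<Delta> > 0\<close> by (simp_all add: \<rho>_def \<eta>_def field_simps)
  have "\<eta> * ?M t < \<rho> * (?M t - L t)"
    using gap(2)[of t] \<rho>(1) by (simp add: \<rho>(4) mult.assoc mult_strict_left_mono)
  then have "(1 - \<rho>) * (?M t - L t) < (1 - \<rho>) * \<Delta>"
    using upper \<rho>(3) by (simp add: left_diff_distrib)
  then have "?M t - L t < \<Delta>"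
    using \<rho>(2) by simp
  then show False
    using gap(1)[of t] by simp
qed

end
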